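(* Let $c\in\mathbb{C}$ with $|c|=1$, let $I=\mathbb{R}$ or $I=[0,\infty)$, and let $f:I\to\mathbb{R}$ be a function that is not identically zero and that is $c$-uniformly recurrent or semi-$c$-periodic. Then $c=1$ or $c=-1$. Moreover, if $f(t)\ge 0$ for all $t\in I$, then $c=1$.
   Context: $\mathbb{N}=\{1,2,\dots\}$; $\mathbb{S}:=\mathbb{N}$ if $I=[0,\infty)$ and $\mathbb{S}:=\mathbb{Z}$ if $I=\mathbb{R}$. The real-valued function $f$ is regarded as a function with values in $E=\mathbb{C}$ in the following definitions. A continuous function $f:I\to E$ is $c$-uniformly recurrent if there exists a strictly increasing sequence $(\alpha_n)$ of positive reals with $\alpha_n\to+\infty$ and $\lim_{n\to\infty}\sup_{t\in I}\|f(t+\alpha_n)-cf(t)\|=0$. A continuous function $f:I\to E$ is semi-$c$-periodic if for every $\varepsilon>0$ there exists $p>0$ such that $\|f(x+mp)-c^{m}f(x)\|\le\varepsilon$ for all $m\in\mathbb{S}$ and all $x\in I$. *)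

theory Defs
  imports "HOL-Analysis.Analysis"
begin

(* The domain I is a set of reals, either UNIV or {0..}; values of f outside I are never used,
   since I + alpha is contained in I for every alpha > 0.
   The supremum is taken in ereal, so that it is infinite when the set of norms is unbounded
   (Sup on type real is unspecified there). *)
definition c_uniformly_recurrent_on :: "real set \<Rightarrow> complex \<Rightarrow> (real \<Rightarrow> complex) \<Rightarrow> bool" where
  "c_uniformly_recurrent_on I c f \<longleftrightarrow>
     continuous_on I f \<and>
     (\<exists>\<alpha> :: nat \<Rightarrow> real.
        strict_mono \<alpha> \<and> (\<forall>n. \<alpha> n > 0) \<and> filterlim \<alpha> at_top sequentially \<and>
        (\<lambda>n. SUP t\<in>I. ereal (norm (f (t + \<alpha> n) - c * f t))) \<longlonglongrightarrow> 0)"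

(* The set S of admissible multiples: all integers for I = UNIV, the integers m >= 1 for I = {0..}. *)
definition multiples_for :: "real set \<Rightarrow> int set" where
  "multiples_for I = (if I = UNIV then UNIV else {1..})"

definition semi_c_periodic_on :: "real set \<Rightarrow> complex \<Rightarrow> (real \<Rightarrow> complex) \<Rightarrow> bool" where
  "semi_c_periodic_on I c f \<longleftrightarrow>
     continuous_on I f \<and>
     (\<forall>\<epsilon>>0. \<exists>p>0. \<forall>m\<in>multiples_for I. \<forall>x\<in>I.
        norm (f (x + of_int m * p) - (c powi m) * f x) \<le> \<epsilon>)"

end

theory Submission
  imports Defs
begin

text \<open>Both recurrence hypotheses yield, for every \<open>\<epsilon> > 0\<close>, a single shift \<open>\<tau> > 0\<close> with
  \<open>\<bar>f (t + \<tau>) - c f t\<bar> \<le> \<epsilon>\<close> on all of \<open>I\<close>, and looking at these shifts from one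
  point \<open>t\<close> with \<open>f t \<noteq> 0\<close> decides the question.
  Since \<open>f\<close> is real, the imaginary part of \<open>f (t + \<tau>) - c f t\<close> is \<open>- Im c \<cdot> f t\<close>, whatever
  \<open>\<tau>\<close> is. Letting \<open>\<epsilon>\<close> tend to 0 gives \<open>Im c = 0\<close>, hence
  \<open>c = \<plusminus>1\<close> on the unit circle. If \<open>c = -1\<close> and \<open>f \<ge> 0\<close>, the difference is
  \<open>f (t + \<tau>) + f t \<ge> f t\<close>, so nothing cancels and \<open>f t \<le> \<epsilon>\<close> for every \<open>\<epsilon>\<close>, contradicting
  \<open>f t > 0\<close>.\<close>

lemma c_uniformly_recurrent_on_shift:
  assumes "c_uniformly_recurrent_on I c g" and "\<epsilon> > 0"
  obtains \<tau> where "\<tau> > 0" and "\<And>t. t \<in> I \<Longrightarrow> norm (g (t + \<tau>) - c * g t) \<le> \<epsilon>"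
proof -
  obtain \<alpha> :: "nat \<Rightarrow> real" where pos: "\<And>n. \<alpha> n > 0"
    and lim: "(\<lambda>n. SUP t\<in>I. ereal (norm (g (t + \<alpha> n) - c * g t))) \<longlonglongrightarrow> 0"
    using assms(1) unfolding c_uniformly_recurrent_on_def by blast
  have "\<forall>\<^sub>F n in sequentially. (SUP t\<in>I. ereal (norm (g (t + \<alpha> n) - c * g t))) < ereal \<epsilon>"
    using order_tendstoD(2)[OF lim] assms(2) by simp
  then obtain n where n: "(SUP t\<in>I. ereal (norm (g (t + \<alpha> n) - c * g t))) < ereal \<epsilon>"
    by (auto dest: eventually_happens)
  have "norm (g (t + \<alpha> n) - c * g t) \<le> \<epsilon>" if "t \<in> I" for t
  proof -
    have "ereal (norm (g (t + \<alpha> n) - c * g t))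
            \<le> (SUP t\<in>I. ereal (norm (g (t + \<alpha> n) - c * g t)))"
      using that by (rule SUP_upper)
    with n have "ereal (norm (g (t + \<alpha> n) - c * g t)) < ereal \<epsilon>"
      by (rule order.strict_trans1[rotated])
    then show ?thesis by simp
  qed
  with pos show ?thesis using that by blast
qed

text \<open>The multiple \<open>m = 1\<close> is admissible on both the line and the half-line.\<close>

lemma semi_c_periodic_on_shift:
  assumes "semi_c_periodic_on I c g" and "\<epsilon> > 0"
  obtains \<tau> where "\<tau> > 0" and "\<And>t. t \<in> I \<Longrightarrow> norm (g (t + \<tau>) - c * g t) \<le> \<epsilon>"
proof -
  obtain p where "p > 0" and p: "\<And>m t. m \<in> multiples_for I \<Longrightarrow> t \<in> I \<Longrightarrow>
      norm (g (t + of_int m * p) - (c powi m) * g t) \<le> \<epsilon>"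
    using assms unfolding semi_c_periodic_on_def by blast
  have "1 \<in> multiples_for I" by (simp add: multiples_for_def)
  with p[of 1] have "norm (g (t + p) - c * g t) \<le> \<epsilon>" if "t \<in> I" for t
    using that by simp
  with \<open>p > 0\<close> show ?thesis using that by blast
qed

theorem proposition2p17:
  fixes c :: complex and I :: "real set" and f :: "real \<Rightarrow> real"
  assumes "norm c = 1"
    and "I = UNIV \<or> I = {0..}"
    and "\<exists>t\<in>I. f t \<noteq> 0"
    and "c_uniformly_recurrent_on I c (\<lambda>t. complex_of_real (f t)) \<or>
         semi_c_periodic_on I c (\<lambda>t. complex_of_real (f t))"
  shows "(c = 1 \<or> c = -1) \<and> ((\<forall>t\<in>I. f t \<ge> 0) \<longrightarrow> c = 1)"
proof -
  obtain t where t: "t \<in> I" "f t \<noteq> 0" using assms(3) by blast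
  have shift: "\<exists>\<tau>>0. norm (complex_of_real (f (t + \<tau>)) - c * complex_of_real (f t)) \<le> \<epsilon>"
    if "\<epsilon> > 0" for \<epsilon>
    using assms(4)
  proof
    assume "c_uniformly_recurrent_on I c (\<lambda>t. complex_of_real (f t))"
    from c_uniformly_recurrent_on_shift[OF this that] t(1) show ?thesis by metis
  next
    assume "semi_c_periodic_on I c (\<lambda>t. complex_of_real (f t))"
    from semi_c_periodic_on_shift[OF this that] t(1) show ?thesis by metis
  qed
  have "\<bar>Im c * f t\<bar> \<le> 0"
  proof (rule field_le_epsilon)
    fix \<epsilon> :: real assume "\<epsilon> > 0"
    then obtain \<tau> where "norm (complex_of_real (f (t + \<tau>)) - c * complex_of_real (f t)) \<le> \<epsilon>"
      using shift by blast
    with abs_Im_le_cmod[of "complex_of_real (f (t + \<tau>)) - c * complex_of_real (f t)"]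
    show "\<bar>Im c * f t\<bar> \<le> 0 + \<epsilon>" by simp
  qed
  with t(2) have "Im c = 0" by simp
  with assms(1) have "\<bar>Re c\<bar> = 1" by (simp add: cmod_def)
  with \<open>Im c = 0\<close> have c: "c = 1 \<or> c = -1" by (auto simp: complex_eq_iff)
  have "c = 1" if nonneg: "\<forall>t\<in>I. f t \<ge> 0"
  proof (rule ccontr)
    assume "c \<noteq> 1"
    with c have "c = -1" by simp
    have "f t \<le> 0"
    proof (rule field_le_epsilon)
      fix \<epsilon> :: real assume "\<epsilon> > 0"
      then obtain \<tau> where "\<tau> > 0"
        and "norm (complex_of_real (f (t + \<tau>)) - c * complex_of_real (f t)) \<le> \<epsilon>"
        using shift by blast
      then have "\<bar>f (t + \<tau>) + f t\<bar> \<le> \<epsilon>"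
        unfolding \<open>c = -1\<close> by (simp flip: of_real_add)
      moreover have "t + \<tau> \<in> I" using assms(2) t(1) \<open>\<tau> > 0\<close> by auto
      with nonneg have "f (t + \<tau>) \<ge> 0" by blast
      ultimately show "f t \<le> 0 + \<epsilon>" by simp
    qed
    moreover have "f t \<ge> 0" using nonneg t(1) by blast
    ultimately show False using t(2) by simp
  qed
  with c show ?thesis by blast
qed

end
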